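(* Let $\alpha_1>0$ and $|\beta_1|<\alpha_1$, and let $Q$ be the quantile function of the hyperbolic distribution $\mathrm{Hyp}(\alpha_1,\beta_1,1,0)$. Put $N_0=2\alpha_1K_1(\gamma_1)/\gamma_1$ with $\gamma_1=\sqrt{\alpha_1^2-\beta_1^2}$, and $$y=-\frac{\ln\left(N_0(\alpha_1-\beta_1)(1-u)\right)}{\alpha_1-\beta_1}.$$ Then $Q$ has the asymptotic expansion $$Q(u)\sim y+\sum_{n=1}^{\infty}\frac{q_n}{y^n}\quad\text{as }u\to1^-,$$ where the coefficients are given recursively by $$q_n=\begin{cases}0,&n=0\\-\frac{\alpha_1}{2(\alpha_1-\beta_1)},&n=1\\-\frac{1}{\alpha_1-\beta_1}\left((n-1)q_{n-1}+\frac1n\sum_{k=1}^{n-1}kb_kc_{n-k}+\alpha_1d_n\right),&n\ge2\end{cases}$$ with $$a_n=\begin{cases}0,&n=0\\ \frac12+q_1,&n=1\\ q_n+d_n,&n\ge2\end{cases},\qquad b_n=\alpha_1a_n-\beta_1q_n,\qquad c_n=\begin{cases}1,&n=0\\ \frac1n\sum_{k=1}^nkb_kc_{n-k},&n\ge1\end{cases},$$ and, for $n\ge2$, $$d_n=\frac{1}{n-1}\sum_{k=0}^{n-2}(k+1)\left(q_{k+1}q_{n-k-2}-a_{k+1}a_{n-k-2}\right).$$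
   Context: $K_\nu$ denotes the modified Bessel function of the second kind. The hyperbolic distribution $\mathrm{Hyp}(\alpha_1,\beta_1,1,0)$ has density on $\mathbb{R}$ $$f(x)=\frac{\gamma_1}{2\alpha_1K_1(\gamma_1)}e^{-\alpha_1\sqrt{1+x^2}+\beta_1x},\qquad \gamma_1=\sqrt{\alpha_1^2-\beta_1^2}.$$ Its distribution function is $F(x)=\int_{-\infty}^xf(t)\,dt$ and its quantile function is $Q=F^{-1}:(0,1)\to\mathbb{R}$. Note $y\to\infty$ as $u\to1^-$. The asymptotic expansion is in the sense of Poincaré: for every $N\ge1$, $Q(u)-y-\sum_{n=1}^Nq_ny^{-n}=o(y^{-N})$ as $u\to1^-$. *)

theory Defs
  imports "HOL-Analysis.Analysis" "HOL-Library.Landau_Symbols"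
begin

text \<open>The modified Bessel function of the second kind, of real order \<open>\<nu>\<close>, for positive real
  argument, given by its standard integral representation (DLMF 10.32.9).\<close>

definition bessel_K :: "real \<Rightarrow> real \<Rightarrow> real" where
  "bessel_K \<nu> x = (LBINT t:{0..}. exp (- x * cosh t) * cosh (\<nu> * t))"

definition hyp_gamma :: "real \<Rightarrow> real \<Rightarrow> real" where
  "hyp_gamma \<alpha> \<beta> = sqrt (\<alpha>\<^sup>2 - \<beta>\<^sup>2)"

text \<open>Density, distribution function and quantile function of \<open>Hyp(\<alpha>, \<beta>, 1, 0)\<close>.  The
  distribution function is a bijection from the reals onto the open unit interval, so
  \<open>hyp_quantile \<alpha> \<beta> u\<close> is meaningful only for \<open>0 < u < 1\<close>.\<close>

definition hyp_density :: "real \<Rightarrow> real \<Rightarrow> real \<Rightarrow> real" where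
  "hyp_density \<alpha> \<beta> x =
     hyp_gamma \<alpha> \<beta> / (2 * \<alpha> * bessel_K 1 (hyp_gamma \<alpha> \<beta>)) * exp (- \<alpha> * sqrt (1 + x\<^sup>2) + \<beta> * x)"

definition hyp_cdf :: "real \<Rightarrow> real \<Rightarrow> real \<Rightarrow> real" where
  "hyp_cdf \<alpha> \<beta> x = (LBINT t:{..x}. hyp_density \<alpha> \<beta> t)"

definition hyp_quantile :: "real \<Rightarrow> real \<Rightarrow> real \<Rightarrow> real" where
  "hyp_quantile \<alpha> \<beta> = inv (hyp_cdf \<alpha> \<beta>)"

definition hyp_N0 :: "real \<Rightarrow> real \<Rightarrow> real" where
  "hyp_N0 \<alpha> \<beta> = 2 * \<alpha> * bessel_K 1 (hyp_gamma \<alpha> \<beta>) / hyp_gamma \<alpha> \<beta>"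

definition hyp_y :: "real \<Rightarrow> real \<Rightarrow> real \<Rightarrow> real" where
  "hyp_y \<alpha> \<beta> u = - ln (hyp_N0 \<alpha> \<beta> * (\<alpha> - \<beta>) * (1 - u)) / (\<alpha> - \<beta>)"

text \<open>The mutually recursive coefficient sequences.  The sequence \<open>d\<close> is only defined for
  \<open>n \<ge> 2\<close>; its values at 0 and 1 are set to 0 here and are never used.\<close>

function coeff_q :: "real \<Rightarrow> real \<Rightarrow> nat \<Rightarrow> real"
  and coeff_a :: "real \<Rightarrow> real \<Rightarrow> nat \<Rightarrow> real"
  and coeff_b :: "real \<Rightarrow> real \<Rightarrow> nat \<Rightarrow> real"
  and coeff_c :: "real \<Rightarrow> real \<Rightarrow> nat \<Rightarrow> real"
  and coeff_d :: "real \<Rightarrow> real \<Rightarrow> nat \<Rightarrow> real"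
where
  "coeff_q \<alpha> \<beta> n =
     (if n = 0 then 0
      else if n = 1 then - \<alpha> / (2 * (\<alpha> - \<beta>))
      else - (1 / (\<alpha> - \<beta>)) *
        (real (n - 1) * coeff_q \<alpha> \<beta> (n - 1)
         + 1 / real n * (\<Sum>k=1..n-1. real k * coeff_b \<alpha> \<beta> k * coeff_c \<alpha> \<beta> (n - k))
         + \<alpha> * coeff_d \<alpha> \<beta> n))"
| "coeff_a \<alpha> \<beta> n =
     (if n = 0 then 0
      else if n = 1 then 1 / 2 + coeff_q \<alpha> \<beta> 1
      else coeff_q \<alpha> \<beta> n + coeff_d \<alpha> \<beta> n)"
| "coeff_b \<alpha> \<beta> n = \<alpha> * coeff_a \<alpha> \<beta> n - \<beta> * coeff_q \<alpha> \<beta> n"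
| "coeff_c \<alpha> \<beta> n =
     (if n = 0 then 1
      else 1 / real n * (\<Sum>k=1..n. real k * coeff_b \<alpha> \<beta> k * coeff_c \<alpha> \<beta> (n - k)))"
| "coeff_d \<alpha> \<beta> n =
     (if n < 2 then 0
      else 1 / real (n - 1) *
        (\<Sum>k=0..n-2. real (k + 1) *
           (coeff_q \<alpha> \<beta> (k + 1) * coeff_q \<alpha> \<beta> (n - k - 2)
            - coeff_a \<alpha> \<beta> (k + 1) * coeff_a \<alpha> \<beta> (n - k - 2))))"
  by pat_completeness auto
termination
  by (relation "Wellfounded.measure (\<lambda>s. case s of
        Inl (Inl (\<alpha>, \<beta>, n)) \<Rightarrow> 5 * n + 1
      | Inl (Inr (\<alpha>, \<beta>, n)) \<Rightarrow> 5 * n + 2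
      | Inr (Inl (\<alpha>, \<beta>, n)) \<Rightarrow> 5 * n + 3
      | Inr (Inr (Inl (\<alpha>, \<beta>, n))) \<Rightarrow> 5 * n + 4
      | Inr (Inr (Inr (\<alpha>, \<beta>, n))) \<Rightarrow> 5 * n)") auto

declare coeff_q.simps [simp del] coeff_a.simps [simp del] coeff_b.simps [simp del]
  coeff_c.simps [simp del] coeff_d.simps [simp del]

end

theory Submission
  imports Defs "HOL-Real_Asymp.Real_Asymp"
begin

text \<open>Let \<open>G(x)\<close> be the integral of \<open>g(t) = exp (- \<alpha> sqrt (1 + t\<^sup>2) + \<beta> t)\<close> over \<open>t > x\<close> and
  \<open>\<delta> = \<alpha> - \<beta>\<close>.  As the density is \<open>g / N\<^sub>0\<close>, the quantile satisfies \<open>\<delta> G(Q) = exp (- \<delta> y)\<close>.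
  Differentiating, \<open>g(Q) Q' = exp (- \<delta> y)\<close>.  The recursion expresses this formally in powers
  of \<open>1 / y\<close>: \<open>a\<close> are the coefficients of \<open>sqrt (1 + Q\<^sup>2) - y\<close>, \<open>b\<close> those of
  \<open>\<alpha> sqrt (1 + Q\<^sup>2) - \<beta> Q - \<delta> y\<close>, and \<open>c\<close> those of its exponential, which is \<open>Q'\<close>.  Hence
  the truncation \<open>P\<close> of the series after \<open>N\<close> terms satisfies this equation up to a factor
  \<open>1 + O(y\<^sup>-\<^sup>N\<^sup>-\<^sup>1)\<close>.  Comparing derivatives of two functions that vanish at infinity gives
  \<open>\<delta> G(P) = exp (- \<delta> y) (1 + O(y\<^sup>-\<^sup>N\<^sup>-\<^sup>1))\<close>, and since the derivative of \<open>ln G\<close> is bounded away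
  from 0 near infinity, \<open>Q - P = O(y\<^sup>-\<^sup>N\<^sup>-\<^sup>1)\<close>.\<close>

section \<open>Functional equations of the coefficient sequences\<close>

text \<open>Reflecting \<open>i\<close> to \<open>m - i\<close> averages the weight \<open>i\<close>
  to \<open>m / 2\<close>. This turns the weighted sums in \<open>coeff_d\<close> into plain Cauchy
  products.\<close>

lemma sum_index_symmetrize:
  fixes f :: "nat \<Rightarrow> real"
  shows "2 * (\<Sum>i\<le>m. real i * f i * f (m - i)) = real m * (\<Sum>i\<le>m. f i * f (m - i))"
proof -
  have "(\<Sum>i\<le>m. real i * f i * f (m - i)) = (\<Sum>i\<le>m. real (m - i) * f (m - i) * f i)"
    by (rule sum.reindex_bij_witness[where i = "\<lambda>i. m - i" and j = "\<lambda>i. m - i"]) auto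
  hence "2 * (\<Sum>i\<le>m. real i * f i * f (m - i))
      = (\<Sum>i\<le>m. real i * f i * f (m - i)) + (\<Sum>i\<le>m. real (m - i) * f (m - i) * f i)"
    by simp
  also have "\<dots> = (\<Sum>i\<le>m. real m * (f i * f (m - i)))"
    unfolding sum.distrib[symmetric]
    by (intro sum.cong refl) (auto simp: of_nat_diff algebra_simps)
  finally show ?thesis by (simp add: sum_distrib_left)
qed

lemma coeff_0 [simp]:
  "coeff_q \<alpha> \<beta> 0 = 0" "coeff_a \<alpha> \<beta> 0 = 0" "coeff_b \<alpha> \<beta> 0 = 0" "coeff_c \<alpha> \<beta> 0 = 1"
  by (simp_all add: coeff_q.simps[of _ _ 0] coeff_a.simps[of _ _ 0] coeff_b.simps[of _ _ 0]
      coeff_c.simps[of _ _ 0])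

text \<open>This is the equation \<open>C' = B' C\<close> for the generating series, which
  characterizes \<open>C = exp B\<close> together with \<open>C 0 = 1\<close>.\<close>

lemma coeff_c_recurrence:
  "real (Suc n) * coeff_c \<alpha> \<beta> (Suc n)
     = (\<Sum>i\<le>n. real (Suc i) * coeff_b \<alpha> \<beta> (Suc i) * coeff_c \<alpha> \<beta> (n - i))"
proof -
  have "real (Suc n) * coeff_c \<alpha> \<beta> (Suc n)
     = (\<Sum>k=1..Suc n. real k * coeff_b \<alpha> \<beta> k * coeff_c \<alpha> \<beta> (Suc n - k))"
    by (subst coeff_c.simps) simp
  also have "\<dots> = (\<Sum>i\<le>n. real (Suc i) * coeff_b \<alpha> \<beta> (Suc i) * coeff_c \<alpha> \<beta> (n - i))"
    by (rule sum.reindex_bij_witness[where i = Suc and j = "\<lambda>i. i - 1"]) auto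
  finally show ?thesis .
qed

text \<open>The value of \<open>q\<close> at 1 is the one that makes \<open>b\<close> vanish at 1,
  which fits a derivative \<open>Q'\<close> without a term in \<open>1 / y\<close>.\<close>

lemma coeff_c_1: "\<alpha> \<noteq> \<beta> \<Longrightarrow> coeff_c \<alpha> \<beta> (Suc 0) = 0"
  using coeff_c_recurrence[of 0 \<alpha> \<beta>]
  by (simp add: coeff_b.simps coeff_a.simps coeff_q.simps[of _ _ "Suc 0"] divide_simps)

text \<open>The series \<open>c\<close> is that of \<open>Q'\<close>: differentiating
  \<open>q / y ^ Suc n\<close> produces the factor \<open>- Suc n\<close> and raises the exponent by
  one. The recursion for \<open>q\<close> is this equation solved for the newest coefficient, which
  enters \<open>c\<close> only through the summand \<open>k = m\<close>.\<close>

lemma coeff_c_eq: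
  assumes "\<alpha> \<noteq> \<beta>"
  shows "coeff_c \<alpha> \<beta> (Suc (Suc n)) = - real (Suc n) * coeff_q \<alpha> \<beta> (Suc n)"
proof -
  define m where "m = Suc (Suc n)"
  define s where "s = (\<Sum>k=1..m - 1. real k * coeff_b \<alpha> \<beta> k * coeff_c \<alpha> \<beta> (m - k))"
  have m: "m \<ge> 2" by (simp add: m_def)
  have "coeff_c \<alpha> \<beta> m
      = 1 / real m * (\<Sum>k=1..m. real k * coeff_b \<alpha> \<beta> k * coeff_c \<alpha> \<beta> (m - k))"
    using m by (subst coeff_c.simps) simp
  also have "{1..m} = insert m {1..m - 1}" using m by auto
  also have "1 / real m * (\<Sum>k\<in>insert m {1..m - 1}. real k * coeff_b \<alpha> \<beta> k * coeff_c \<alpha> \<beta> (m - k))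
      = coeff_b \<alpha> \<beta> m + 1 / real m * s"
    using m by (subst sum.insert) (auto simp: s_def field_simps)
  finally have c: "coeff_c \<alpha> \<beta> m = coeff_b \<alpha> \<beta> m + 1 / real m * s" .
  have "coeff_q \<alpha> \<beta> m = - (1 / (\<alpha> - \<beta>)) *
      (real (m - 1) * coeff_q \<alpha> \<beta> (m - 1) + 1 / real m * s + \<alpha> * coeff_d \<alpha> \<beta> m)"
    using m unfolding s_def by (subst coeff_q.simps) simp
  hence q: "(\<alpha> - \<beta>) * coeff_q \<alpha> \<beta> m
      = - (real (m - 1) * coeff_q \<alpha> \<beta> (m - 1) + 1 / real m * s + \<alpha> * coeff_d \<alpha> \<beta> m)"
    using assms by simp
  have "coeff_b \<alpha> \<beta> m = (\<alpha> - \<beta>) * coeff_q \<alpha> \<beta> m + \<alpha> * coeff_d \<alpha> \<beta> m"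
    using m by (simp add: coeff_b.simps coeff_a.simps algebra_simps)
  with q c have "coeff_c \<alpha> \<beta> m = - real (m - 1) * coeff_q \<alpha> \<beta> (m - 1)" by simp
  thus ?thesis by (simp add: m_def)
qed

text \<open>Compares the coefficients of \<open>1 / y ^ Suc n\<close> in
  \<open>(y + A)\<^sup>2 = 1 + (y + Q)\<^sup>2\<close>, where \<open>A\<close> and \<open>Q\<close>
  are the series of \<open>a\<close> and \<open>q\<close> in \<open>1 / y\<close>; the cross terms
  with \<open>y\<close> give the left-hand side.\<close>

lemma coeff_a_eq:
  "2 * (coeff_a \<alpha> \<beta> (Suc (Suc n)) - coeff_q \<alpha> \<beta> (Suc (Suc n)))
     = (\<Sum>i\<le>Suc n. coeff_q \<alpha> \<beta> i * coeff_q \<alpha> \<beta> (Suc n - i))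
       - (\<Sum>i\<le>Suc n. coeff_a \<alpha> \<beta> i * coeff_a \<alpha> \<beta> (Suc n - i))"
proof -
  \<comment> \<open>The shift \<open>i = k + 1\<close> adds only the summand \<open>i = 0\<close>,
    which its weight annihilates.\<close>
  have *: "(\<Sum>k=0..n. real (k + 1) * (f (k + 1) * f (n - k)))
      = (\<Sum>i\<le>Suc n. real i * f i * f (Suc n - i))" for f :: "nat \<Rightarrow> real"
    by (subst sum.atMost_Suc_shift) (simp add: mult.assoc atLeast0AtMost)
  have "real (Suc n) * coeff_d \<alpha> \<beta> (Suc (Suc n))
      = (\<Sum>k=0..n. real (k + 1) * (coeff_q \<alpha> \<beta> (k + 1) * coeff_q \<alpha> \<beta> (n - k)))
       - (\<Sum>k=0..n. real (k + 1) * (coeff_a \<alpha> \<beta> (k + 1) * coeff_a \<alpha> \<beta> (n - k)))"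
    by (subst coeff_d.simps) (simp add: sum_subtractf[symmetric] right_diff_distrib)
  hence "real (Suc n) * (2 * coeff_d \<alpha> \<beta> (Suc (Suc n)))
      = 2 * (\<Sum>i\<le>Suc n. real i * coeff_q \<alpha> \<beta> i * coeff_q \<alpha> \<beta> (Suc n - i))
       - 2 * (\<Sum>i\<le>Suc n. real i * coeff_a \<alpha> \<beta> i * coeff_a \<alpha> \<beta> (Suc n - i))"
    unfolding * by simp
  hence "2 * coeff_d \<alpha> \<beta> (Suc (Suc n))
      = (\<Sum>i\<le>Suc n. coeff_q \<alpha> \<beta> i * coeff_q \<alpha> \<beta> (Suc n - i))
       - (\<Sum>i\<le>Suc n. coeff_a \<alpha> \<beta> i * coeff_a \<alpha> \<beta> (Suc n - i))"
    unfolding sum_index_symmetrize right_diff_distrib[symmetric] by (simp del: of_nat_Suc)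
  thus ?thesis by (simp add: coeff_a.simps[of _ _ "Suc (Suc n)"])
qed

section \<open>Truncated series as polynomials in \<open>1 / y\<close>\<close>

definition trunc_poly :: "(nat \<Rightarrow> real) \<Rightarrow> nat \<Rightarrow> real poly" where
  "trunc_poly f N = (\<Sum>n\<le>N. monom (f n) n)"

lemma coeff_trunc_poly [simp]: "coeff (trunc_poly f N) n = (if n \<le> N then f n else 0)"
  by (simp add: trunc_poly_def coeff_sum)

lemma poly_trunc_poly: "poly (trunc_poly f N) x = (\<Sum>n\<le>N. f n * x ^ n)"
  by (simp add: trunc_poly_def poly_sum poly_monom)

text \<open>On the unit interval each surviving power is at most \<open>x ^ M\<close>, so the sum of
  the absolute coefficients serves as \<open>K\<close>.\<close>

lemma poly_bound_of_low_coeffs_0: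
  fixes p :: "real poly"
  assumes "\<And>n. n < M \<Longrightarrow> coeff p n = 0"
  obtains K where "K \<ge> 0" "\<And>x. 0 \<le> x \<Longrightarrow> x \<le> 1 \<Longrightarrow> \<bar>poly p x\<bar> \<le> K * x ^ M"
proof
  show "0 \<le> (\<Sum>n\<le>degree p. \<bar>coeff p n\<bar>)" by (simp add: sum_nonneg)
  fix x :: real assume x: "0 \<le> x" "x \<le> 1"
  have "\<bar>poly p x\<bar> \<le> (\<Sum>n\<le>degree p. \<bar>coeff p n * x ^ n\<bar>)"
    unfolding poly_altdef by (rule sum_abs)
  also have "\<dots> \<le> (\<Sum>n\<le>degree p. \<bar>coeff p n\<bar> * x ^ M)"
  proof (rule sum_mono)
    fix n
    show "\<bar>coeff p n * x ^ n\<bar> \<le> \<bar>coeff p n\<bar> * x ^ M"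
      using assms[of n] x by (cases "n < M") (auto simp: abs_mult intro!: mult_left_mono power_decreasing)
  qed
  finally show "\<bar>poly p x\<bar> \<le> (\<Sum>n\<le>degree p. \<bar>coeff p n\<bar>) * x ^ M"
    by (simp add: sum_distrib_right)
qed

lemma poly_bigo_of_low_coeffs_0:
  fixes p :: "real poly"
  assumes "\<And>n. n < M \<Longrightarrow> coeff p n = 0"
  shows "(\<lambda>y. poly p (1 / y)) \<in> O(\<lambda>y. 1 / y ^ M)"
proof -
  obtain K where K: "\<And>x. 0 \<le> x \<Longrightarrow> x \<le> 1 \<Longrightarrow> \<bar>poly p x\<bar> \<le> K * x ^ M"
    using poly_bound_of_low_coeffs_0[OF assms] by blast
  show ?thesis
  proof (rule bigoI[where c = K])
    show "\<forall>\<^sub>F y in at_top. norm (poly p (1 / y)) \<le> K * norm (1 / y ^ M)"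
      using eventually_ge_at_top[of 1]
    proof eventually_elim
      case (elim y)
      thus ?case using K[of "1 / y"] by (simp add: power_one_over abs_mult power_abs)
    qed
  qed
qed

text \<open>The defect of \<open>C\<close> as a solution of \<open>C' = B' C\<close> controls \<open>exp (- B) C - 1\<close>, because
  the derivative of \<open>exp (- B) C\<close> is \<open>exp (- B) (C' - B' C)\<close>.\<close>
lemma poly_exp_bigo:
  fixes B C :: "real poly"
  assumes "coeff B 0 = 0" "coeff C 0 = 1"
    and "\<And>n. n < M \<Longrightarrow> coeff (pderiv C - pderiv B * C) n = 0"
  shows "(\<lambda>y. exp (- poly B (1 / y)) * poly C (1 / y) - 1) \<in> O(\<lambda>y. 1 / y ^ Suc M)"
proof -
  define R where "R = pderiv C - pderiv B * C"
  define f where "f x = exp (- poly B x) * poly C x" for x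
  obtain K where K: "K \<ge> 0" "\<And>x. 0 \<le> x \<Longrightarrow> x \<le> 1 \<Longrightarrow> \<bar>poly R x\<bar> \<le> K * x ^ M"
    using poly_bound_of_low_coeffs_0[OF assms(3)] unfolding R_def by blast
  have deriv: "(f has_real_derivative exp (- poly B x) * poly R x) (at x)" for x
    unfolding f_def R_def by (auto intro!: derivative_eq_intros simp: algebra_simps)
  have "continuous_on {0..1} (\<lambda>x. exp (- poly B x))" by (intro continuous_intros)
  hence "bounded ((\<lambda>x. exp (- poly B x)) ` {0..1})"
    by (intro compact_imp_bounded compact_continuous_image) auto
  then obtain L where L: "L > 0" "\<And>x. 0 \<le> x \<Longrightarrow> x \<le> 1 \<Longrightarrow> exp (- poly B x) \<le> L"
    unfolding bounded_pos by auto
  have f0: "f 0 = 1" using assms(1,2) by (simp add: f_def poly_0_coeff_0)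
  have bound: "\<bar>f x - 1\<bar> \<le> L * K * x ^ Suc M" if x: "0 < x" "x \<le> 1" for x
  proof -
    \<comment> \<open>The factor \<open>x\<close> from the mean value theorem raises the order from
      \<open>M\<close> to \<open>Suc M\<close>.\<close>
    obtain z where z: "0 < z" "z < x" "f x - f 0 = (x - 0) * (exp (- poly B z) * poly R z)"
      using MVT2[of 0 x f "\<lambda>x. exp (- poly B x) * poly R x"] deriv x by auto
    have "\<bar>exp (- poly B z) * poly R z\<bar> \<le> L * (K * z ^ M)"
      unfolding abs_mult using L K z x by (intro mult_mono) auto
    also have "\<dots> \<le> L * (K * x ^ M)"
      using L K z by (intro mult_left_mono power_mono) auto
    finally have "x * \<bar>exp (- poly B z) * poly R z\<bar> \<le> x * (L * (K * x ^ M))"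
      using x by (intro mult_left_mono) auto
    thus ?thesis using z x f0 by (simp add: abs_mult mult_ac)
  qed
  show ?thesis
  proof (rule bigoI[where c = "L * K"])
    show "\<forall>\<^sub>F y in at_top. norm (exp (- poly B (1 / y)) * poly C (1 / y) - 1)
        \<le> L * K * norm (1 / y ^ Suc M)"
      using eventually_ge_at_top[of 1]
    proof eventually_elim
      case (elim y)
      thus ?case using bound[of "1 / y"]
        by (simp add: f_def power_one_over abs_mult power_abs)
    qed
  qed
qed

section \<open>The integral of the kernel and the Bessel function\<close>

lemma cosh_ge_quadratic: "cosh (t::real) \<ge> (1 + t\<^sup>2) / 4"
proof -
  have *: "cosh t \<ge> (1 + t\<^sup>2) / 4" if "t \<ge> 0" for t :: real
  proof -
    have "1 + t + t\<^sup>2 / 2 \<le> exp t" by (rule exp_lower_Taylor_quadratic[OF that])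
    moreover have "exp t / 2 \<le> cosh t" by (simp add: cosh_def)
    ultimately show ?thesis using that by (simp add: field_simps)
  qed
  show ?thesis using *[of t] *[of "- t"] by (cases "t \<ge> 0") auto
qed

lemma integrable_inverse_1_plus_sq: "integrable lborel (\<lambda>x::real. inverse (1 + x\<^sup>2))"
proof -
  have "set_integrable lborel (einterval (-\<infinity>) \<infinity>) (\<lambda>x::real. inverse (1 + x\<^sup>2))"
  proof (rule interval_integral_FTC_nonneg(1)[where F = arctan])
    show "((arctan \<circ> real_of_ereal) \<longlongrightarrow> - (pi / 2)) (at_right (- \<infinity>))"
      by (auto simp: ereal_tendsto_simps intro: tendsto_arctan_at_bot)
    show "((arctan \<circ> real_of_ereal) \<longlongrightarrow> pi / 2) (at_left \<infinity>)"
      by (auto simp: ereal_tendsto_simps intro: tendsto_arctan_at_top)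
  qed (auto intro!: DERIV_arctan continuous_intros AE_I2 simp: add_nonneg_eq_0_iff)
  thus ?thesis by (simp add: set_integrable_def)
qed

text \<open>With \<open>c = cosh t\<close>, the bound \<open>2 / (\<gamma> * c)\<^sup>2\<close> for
  the exponential leaves a multiple of \<open>1 / c\<close>, and \<open>cosh_ge_quadratic\<close>
  compares that with the derivative of arctan. The constant 8 is this 2 times the 4 of the quadratic
  bound.\<close>

lemma integrable_bessel_kernel:
  assumes "(\<gamma>::real) > 0" and "f \<in> borel_measurable borel" "\<And>t. \<bar>f t\<bar> \<le> K * cosh t"
  shows "integrable lborel (\<lambda>t. exp (- \<gamma> * cosh t) * f t)"
proof (rule Bochner_Integration.integrable_bound)
  show "integrable lborel (\<lambda>x::real. (8 * K / \<gamma>\<^sup>2) * inverse (1 + x\<^sup>2))"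
    using integrable_inverse_1_plus_sq by simp
  show "(\<lambda>t. exp (- \<gamma> * cosh t) * f t) \<in> borel_measurable lborel"
  proof -
    have "(\<lambda>t::real. exp (- \<gamma> * cosh t)) \<in> borel_measurable borel"
      by (intro borel_measurable_continuous_onI continuous_intros)
    thus ?thesis using assms(2) by simp
  qed
  have K: "K \<ge> 0" using assms(3)[of 0] by simp
  show "AE t in lborel. norm (exp (- \<gamma> * cosh t) * f t) \<le> norm (8 * K / \<gamma>\<^sup>2 * inverse (1 + t\<^sup>2))"
  proof (rule AE_I2)
    fix t :: real
    define c where "c = cosh t"
    have c: "c \<ge> (1 + t\<^sup>2) / 4" unfolding c_def by (rule cosh_ge_quadratic)
    have c0: "c > 0" by (simp add: c_def)
    have "(\<gamma> * c)\<^sup>2 / 2 \<le> exp (\<gamma> * c)"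
      using exp_lower_Taylor_quadratic[of "\<gamma> * c"] assms(1) c0 by (smt (verit) mult_pos_pos)
    hence "exp (- \<gamma> * c) \<le> 2 / (\<gamma> * c)\<^sup>2"
      using assms(1) c0 by (simp add: exp_minus field_simps)
    hence "exp (- \<gamma> * c) * \<bar>f t\<bar> \<le> 2 / (\<gamma> * c)\<^sup>2 * (K * c)"
      using assms(3)[of t] unfolding c_def by (intro mult_mono) auto
    also have "\<dots> = 2 * K / \<gamma>\<^sup>2 * (1 / c)" using assms(1) c0 by (simp add: field_simps power2_eq_square)
    also have "\<dots> \<le> 2 * K / \<gamma>\<^sup>2 * (4 * inverse (1 + t\<^sup>2))"
    proof (rule mult_left_mono)
      have "1 + t\<^sup>2 > 0" by (simp add: add_pos_nonneg)
      thus "1 / c \<le> 4 * inverse (1 + t\<^sup>2)" using c c0 by (simp add: field_simps)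
    qed (use K in auto)
    finally show "norm (exp (- \<gamma> * cosh t) * f t) \<le> norm (8 * K / \<gamma>\<^sup>2 * inverse (1 + t\<^sup>2))"
      using K by (simp add: c_def abs_mult add_nonneg_pos)
  qed
qed

lemma integral_odd_eq_0:
  fixes f :: "real \<Rightarrow> real"
  assumes "\<And>x. f (- x) = - f x"
  shows "(LBINT x. f x) = 0"
  using lborel_integral_real_affine[of "-1" f 0] assms by simp

lemma integral_even:
  fixes f :: "real \<Rightarrow> real"
  assumes "\<And>x. f (- x) = f x" "integrable lborel f"
  shows "(LBINT x. f x) = 2 * (LBINT x:{0..}. f x)"
proof -
  have int: "set_integrable lborel A f" if "A \<in> sets borel" for A
    using assms(2) that unfolding set_integrable_def
    by (intro integrable_mult_indicator) auto
  have "{..<0} \<union> {0..} = (UNIV :: real set)" by auto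
  hence "(LBINT x. f x) = (LBINT x:{..<0} \<union> {0..}. f x)"
    by (simp add: set_lebesgue_integral_def)
  also have "\<dots> = (LBINT x:{..<0}. f x) + (LBINT x:{0..}. f x)"
    by (rule set_integral_Un) (auto intro: int)
  also have "(LBINT x:{..<0}. f x) = (LBINT x:{0<..}. f x)"
    by (subst set_integral_reflect) (simp add: assms(1) greaterThan_def)
  also have "\<dots> = (LBINT x:{0..}. f x)"
    unfolding set_lebesgue_integral_def
  proof (rule integral_cong_AE)
    show "AE x in lborel. indicator {0<..} x *\<^sub>R f x = indicator {0..} x *\<^sub>R f x"
      using AE_lborel_singleton[of "0::real"] by eventually_elim (auto simp: indicator_def)
  qed (use assms(2) in auto)
  finally show ?thesis by simp
qed

text \<open>The \<open>g\<close> of the overview: the density is this function divided by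
  \<open>hyp_N0\<close>.\<close>

definition hyp_kernel :: "real \<Rightarrow> real \<Rightarrow> real \<Rightarrow> real" where
  "hyp_kernel \<alpha> \<beta> t = exp (- \<alpha> * sqrt (1 + t\<^sup>2) + \<beta> * t)"

text \<open>Substituting \<open>x = sinh (t + s)\<close>, where \<open>\<alpha> = \<gamma> cosh s\<close> and \<open>\<beta> = \<gamma> sinh s\<close>, turns the
  integral into that of \<open>exp (- \<gamma> cosh t) cosh (t + s)\<close>.\<close>
lemma hyp_kernel_integral:
  assumes "\<alpha> > 0" and "\<bar>\<beta>\<bar> < \<alpha>"
  shows "integrable lborel (hyp_kernel \<alpha> \<beta>)" "(LBINT t. hyp_kernel \<alpha> \<beta> t) = hyp_N0 \<alpha> \<beta>"
proof -
  define \<gamma> where "\<gamma> = hyp_gamma \<alpha> \<beta>"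
  have "\<alpha>\<^sup>2 - \<beta>\<^sup>2 > 0" using assms by (simp add: abs_square_less_1 power2_strict_mono)
  hence \<gamma>: "\<gamma> > 0" "\<gamma>\<^sup>2 = \<alpha>\<^sup>2 - \<beta>\<^sup>2" by (auto simp: \<gamma>_def hyp_gamma_def)
  define s where "s = arsinh (\<beta> / \<gamma>)"
  have \<beta>: "\<beta> = \<gamma> * sinh s" using \<gamma> by (simp add: s_def sinh_arsinh_real)
  have "(\<gamma> * cosh s)\<^sup>2 = \<alpha>\<^sup>2"
    using \<gamma> by (simp add: power_mult_distrib cosh_square_eq algebra_simps \<beta>)
  hence \<alpha>: "\<alpha> = \<gamma> * cosh s"
    using assms(1) \<gamma>(1) by (simp add: power2_eq_iff_nonneg less_imp_le)
  hence cosh_s: "cosh s = \<alpha> / \<gamma>" using \<gamma>(1) by simp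
  define k where "k f t = exp (- \<gamma> * cosh t) * f t" for f and t :: real
  have meas: "(\<lambda>t::real. cosh t) \<in> borel_measurable borel"
    "(\<lambda>t::real. sinh t) \<in> borel_measurable borel"
    by (auto intro!: borel_measurable_continuous_onI continuous_intros)
  have sinh_le: "\<bar>sinh t\<bar> \<le> cosh t" for t :: real
    using sinh_le_cosh_real[of t] sinh_le_cosh_real[of "- t"] by simp
  have int: "integrable lborel (k cosh)" "integrable lborel (k sinh)"
    unfolding k_def
    by (rule integrable_bessel_kernel[where K = 1, OF \<gamma>(1)]; use meas sinh_le in simp)+
  \<comment> \<open>The integrand splits into an even and an odd part. Only the even one
    contributes, with factor \<open>cosh s = \<alpha> / \<gamma>\<close>, and its integral is twice
    the Bessel integral.\<close>
  have split: "k (\<lambda>t. cosh (t + s)) = (\<lambda>t. cosh s * k cosh t + sinh s * k sinh t)"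
    by (simp add: k_def cosh_add algebra_simps fun_eq_iff)
  have ints: "integrable lborel (k (\<lambda>t. cosh (t + s)))"
    unfolding split using int by simp
  \<comment> \<open>The exponent becomes
    \<open>- \<gamma> * (cosh (t + s) * cosh s - sinh (t + s) * sinh s)\<close>, which the addition
    formula collapses.\<close>
  have kernel: "hyp_kernel \<alpha> \<beta> (sinh (t + s)) = exp (- \<gamma> * cosh t)" for t
  proof -
    have "sqrt (1 + (sinh (t + s))\<^sup>2) = cosh (t + s)"
      by (intro real_sqrt_unique) (simp_all add: cosh_square_eq)
    moreover have "cosh t = cosh (t + s) * cosh s - sinh (t + s) * sinh s"
      using cosh_diff[of "t + s" s] by simp
    ultimately show ?thesis
      by (simp only: hyp_kernel_def \<alpha> \<beta>) (simp add: algebra_simps)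
  qed
  have shift: "filterlim (\<lambda>t. t + s) at_bot at_bot" "filterlim (\<lambda>t. t + s) at_top at_top"
    by real_asymp+
  have deriv: "((\<lambda>t. sinh (t + s)) has_real_derivative cosh (t + s)) (at t)" for t
    by (auto intro!: derivative_eq_intros)
  have cont: "isCont (hyp_kernel \<alpha> \<beta>) x" "isCont (\<lambda>t. cosh (t + s)) x" for x
    unfolding hyp_kernel_def by (intro continuous_intros; simp)+
  have nonneg: "0 \<le> hyp_kernel \<alpha> \<beta> x" "0 \<le> cosh (t + s)" for x t
    by (simp_all add: hyp_kernel_def)
  have lim: "((ereal \<circ> (\<lambda>t. sinh (t + s)) \<circ> real_of_ereal) \<longlongrightarrow> -\<infinity>) (at_right (-\<infinity>))"
    "((ereal \<circ> (\<lambda>t. sinh (t + s)) \<circ> real_of_ereal) \<longlongrightarrow> \<infinity>) (at_left \<infinity>)"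
    using filterlim_compose[OF sinh_real_at_bot shift(1)]
      filterlim_compose[OF sinh_real_at_top shift(2)]
    unfolding ereal_tendsto_simps by simp_all
  have int_subst: "set_integrable lborel (einterval (-\<infinity>) \<infinity>)
      (\<lambda>t. hyp_kernel \<alpha> \<beta> (sinh (t + s)) * cosh (t + s))"
    using ints by (simp add: kernel k_def[abs_def] set_integrable_def)
  have "(-\<infinity>::ereal) < \<infinity>" by simp
  note sub = interval_integral_substitution_nonneg[where f = "hyp_kernel \<alpha> \<beta>",
      OF this deriv cont(1) cont(2) nonneg(1) nonneg(2) lim int_subst]
  from sub(1) show "integrable lborel (hyp_kernel \<alpha> \<beta>)" by (simp add: set_integrable_def)
  from sub(2) have "(LBINT t. hyp_kernel \<alpha> \<beta> t) = (LBINT t. k (\<lambda>t. cosh (t + s)) t)"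
    by (simp add: interval_lebesgue_integral_def set_lebesgue_integral_def kernel k_def)
  also have "\<dots> = cosh s * (LBINT t. k cosh t) + sinh s * (LBINT t. k sinh t)"
    unfolding split using int by simp
  also have "(LBINT t. k sinh t) = 0" by (rule integral_odd_eq_0) (simp add: k_def)
  also have "(LBINT t. k cosh t) = 2 * (LBINT t:{0..}. k cosh t)"
    by (rule integral_even[OF _ int(1)]) (simp add: k_def)
  also have "(LBINT t:{0..}. k cosh t) = bessel_K 1 \<gamma>"
    by (simp add: bessel_K_def k_def)
  finally show "(LBINT t. hyp_kernel \<alpha> \<beta> t) = hyp_N0 \<alpha> \<beta>"
    unfolding hyp_N0_def \<gamma>_def[symmetric] using \<gamma>(1) by (simp add: cosh_s)
qed

section \<open>The tail integral and its relation to the quantile\<close>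

text \<open>The \<open>G\<close> of the overview, written as a complement so that the integral over
  \<open>{..x}\<close> is the one occurring in \<open>hyp_cdf\<close>.\<close>

definition hyp_tail :: "real \<Rightarrow> real \<Rightarrow> real \<Rightarrow> real" where
  "hyp_tail \<alpha> \<beta> x = (LBINT t. hyp_kernel \<alpha> \<beta> t) - (LBINT t:{..x}. hyp_kernel \<alpha> \<beta> t)"

lemma hyp_tail_has_derivative:
  assumes "\<alpha> > 0" and "\<bar>\<beta>\<bar> < \<alpha>"
  shows "(hyp_tail \<alpha> \<beta> has_real_derivative - hyp_kernel \<alpha> \<beta> x) (at x)"
proof -
  let ?g = "hyp_kernel \<alpha> \<beta>"
  have g: "set_integrable lborel A ?g" if "A \<in> sets borel" for A
    using hyp_kernel_integral(1)[OF assms] that unfolding set_integrable_def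
    by (intro integrable_mult_indicator) auto
  have cont: "continuous_on S ?g" for S
    unfolding hyp_kernel_def by (intro continuous_intros)
  \<comment> \<open>The fundamental theorem is applied on a compact interval around
    \<open>x\<close>; cutting the ray at the fixed point \<open>x - 1\<close> changes the integral
    by a constant.\<close>
  have "((\<lambda>u. integral {x - 1..u} ?g) has_real_derivative ?g x) (at x within {x - 1..x + 1})"
    by (rule integral_has_real_derivative) (auto intro: cont)
  hence "((\<lambda>u. integral {x - 1..u} ?g) has_real_derivative ?g x) (at x)"
    by (simp add: at_within_Icc_at)
  hence deriv: "((\<lambda>u. (LBINT t. ?g t) - (LBINT t:{..<x - 1}. ?g t) - integral {x - 1..u} ?g)
      has_real_derivative - ?g x) (at x)"
    by (auto intro!: derivative_eq_intros)
  have eq: "(LBINT t. ?g t) - (LBINT t:{..<x - 1}. ?g t) - integral {x - 1..u} ?g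
      = hyp_tail \<alpha> \<beta> u" if "u \<in> {x - 1<..}" for u
  proof -
    have "(LBINT t:{..u}. ?g t) = (LBINT t:{..<x - 1} \<union> {x - 1..u}. ?g t)"
      using that by (simp add: ivl_disj_un)
    also have "\<dots> = (LBINT t:{..<x - 1}. ?g t) + (LBINT t:{x - 1..u}. ?g t)"
      by (rule set_integral_Un) (auto intro: g)
    also have "(LBINT t:{x - 1..u}. ?g t) = integral {x - 1..u} ?g"
      by (rule set_borel_integral_eq_integral(2)) (auto intro: g)
    finally show ?thesis by (simp add: hyp_tail_def)
  qed
  show ?thesis
    by (rule has_field_derivative_transform_within_open[OF deriv, where S = "{x - 1<..}"])
       (use eq in auto)
qed

lemma hyp_tail_tendsto_0:
  assumes "\<alpha> > 0" and "\<bar>\<beta>\<bar> < \<alpha>"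
  shows "(hyp_tail \<alpha> \<beta> \<longlongrightarrow> 0) at_top"
proof -
  have "((\<lambda>x. LBINT t:{..x}. hyp_kernel \<alpha> \<beta> t) \<longlongrightarrow> (LBINT t. hyp_kernel \<alpha> \<beta> t)) at_top"
    unfolding set_lebesgue_integral_def
    by (rule tendsto_integral_at_top) (auto intro: hyp_kernel_integral(1)[OF assms])
  from tendsto_diff[OF tendsto_const[of "LBINT t. hyp_kernel \<alpha> \<beta> t"] this]
  show ?thesis unfolding hyp_tail_def by simp
qed

lemma hyp_tail_strict_antimono:
  assumes "\<alpha> > 0" and "\<bar>\<beta>\<bar> < \<alpha>" and "a < b"
  shows "hyp_tail \<alpha> \<beta> b < hyp_tail \<alpha> \<beta> a"
proof (rule DERIV_neg_imp_decreasing[OF assms(3)])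
  fix x
  show "\<exists>y. (hyp_tail \<alpha> \<beta> has_real_derivative y) (at x) \<and> y < 0"
    using hyp_tail_has_derivative[OF assms(1,2), of x]
    by (rule_tac exI[of _ "- hyp_kernel \<alpha> \<beta> x"]) (simp add: hyp_kernel_def)
qed

text \<open>The limit 0 at infinity only yields a weak inequality; passing through
  \<open>x + 1\<close> recovers the strict one.\<close>

lemma hyp_tail_pos:
  assumes "\<alpha> > 0" and "\<bar>\<beta>\<bar> < \<alpha>"
  shows "hyp_tail \<alpha> \<beta> x > 0"
proof -
  note dec = hyp_tail_strict_antimono[OF assms]
  have "hyp_tail \<alpha> \<beta> (x + 1) \<ge> 0"
    by (rule tendsto_upperbound[OF hyp_tail_tendsto_0[OF assms]])
       (auto intro!: eventually_mono[OF eventually_gt_at_top[of "x + 1"]] less_imp_le dec)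
  with dec[of x "x + 1"] show ?thesis by simp
qed

text \<open>Positivity of \<open>hyp_N0\<close>, the total integral, comes from that of the tail at
  0.\<close>

lemma hyp_tail_eq_cdf:
  assumes "\<alpha> > 0" and "\<bar>\<beta>\<bar> < \<alpha>"
  shows "hyp_N0 \<alpha> \<beta> > 0" "hyp_tail \<alpha> \<beta> x = hyp_N0 \<alpha> \<beta> * (1 - hyp_cdf \<alpha> \<beta> x)"
proof -
  have "(LBINT t:{..0}. hyp_kernel \<alpha> \<beta> t) \<ge> 0"
    by (simp add: set_lebesgue_integral_def hyp_kernel_def)
  hence "hyp_tail \<alpha> \<beta> 0 \<le> hyp_N0 \<alpha> \<beta>"
    by (simp add: hyp_tail_def hyp_kernel_integral(2)[OF assms])
  thus N0: "hyp_N0 \<alpha> \<beta> > 0" using hyp_tail_pos[OF assms, of 0] by linarith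
  have "hyp_density \<alpha> \<beta> t = (1 / hyp_N0 \<alpha> \<beta>) * hyp_kernel \<alpha> \<beta> t" for t
    by (simp add: hyp_density_def hyp_N0_def hyp_kernel_def)
  hence "hyp_cdf \<alpha> \<beta> x = (1 / hyp_N0 \<alpha> \<beta>) * (LBINT t:{..x}. hyp_kernel \<alpha> \<beta> t)"
    by (simp add: hyp_cdf_def)
  thus "hyp_tail \<alpha> \<beta> x = hyp_N0 \<alpha> \<beta> * (1 - hyp_cdf \<alpha> \<beta> x)"
    using N0 by (simp add: hyp_tail_def hyp_kernel_integral(2)[OF assms] field_simps)
qed

text \<open>Since the quantile is an \<open>inv\<close>, \<open>u\<close> has to be in the range of
  the distribution function. For \<open>u\<close> between the value at 0 and 1, the intermediate
  value theorem on \<open>{0..X}\<close> with \<open>X\<close> far out supplies a preimage.\<close>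

lemma hyp_tail_quantile:
  assumes "\<alpha> > 0" and "\<bar>\<beta>\<bar> < \<alpha>"
  shows "\<forall>\<^sub>F u in at_left 1. hyp_tail \<alpha> \<beta> (hyp_quantile \<alpha> \<beta> u) = hyp_N0 \<alpha> \<beta> * (1 - u)"
proof -
  let ?G = "hyp_tail \<alpha> \<beta>" and ?N = "hyp_N0 \<alpha> \<beta>"
  have N: "?N > 0" by (rule hyp_tail_eq_cdf(1)[OF assms])
  have "hyp_cdf \<alpha> \<beta> 0 < 1"
    using hyp_tail_pos[OF assms, of 0] N unfolding hyp_tail_eq_cdf(2)[OF assms]
    by (simp add: zero_less_mult_iff)
  hence "\<forall>\<^sub>F u in at_left 1. u \<in> {hyp_cdf \<alpha> \<beta> 0<..<1}"
    by (intro eventually_at_leftI[of "hyp_cdf \<alpha> \<beta> 0"]) auto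
  thus ?thesis
  proof eventually_elim
    case (elim u)
    have "\<forall>\<^sub>F x in at_top. ?G x < ?N * (1 - u) \<and> x > 0"
      using elim N
      by (intro eventually_conj order_tendstoD(2)[OF hyp_tail_tendsto_0[OF assms]]
          eventually_gt_at_top) auto
    then obtain X where X: "?G X < ?N * (1 - u)" "X > 0"
      using eventually_happens by force
    have "\<exists>x\<ge>0. x \<le> X \<and> ?G x = ?N * (1 - u)"
    proof (rule IVT2)
      show "?N * (1 - u) \<le> ?G 0" using elim N unfolding hyp_tail_eq_cdf(2)[OF assms] by simp
      show "\<forall>x. 0 \<le> x \<and> x \<le> X \<longrightarrow> isCont ?G x"
        using DERIV_isCont[OF hyp_tail_has_derivative[OF assms]] by blast
    qed (use X in auto)
    then obtain x where "?G x = ?N * (1 - u)" by blast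
    hence "u = hyp_cdf \<alpha> \<beta> x" using N unfolding hyp_tail_eq_cdf(2)[OF assms] by simp
    hence "hyp_cdf \<alpha> \<beta> (hyp_quantile \<alpha> \<beta> u) = u"
      unfolding hyp_quantile_def by (intro f_inv_into_f) auto
    thus ?case unfolding hyp_tail_eq_cdf(2)[OF assms] by simp
  qed
qed

section \<open>Comparison of tail and kernel near infinity\<close>

text \<open>The comparison principle behind both tail estimates: an inequality between functions
  vanishing at infinity follows from one between their derivatives.\<close>

lemma nonneg_if_decreasing_to_0:
  fixes f f' :: "real \<Rightarrow> real"
  assumes "\<And>x. x \<ge> X \<Longrightarrow> (f has_real_derivative f' x) (at x)"
    and "\<And>x. x \<ge> X \<Longrightarrow> f' x \<le> 0" and "(f \<longlongrightarrow> 0) at_top" and "x \<ge> X"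
  shows "f x \<ge> 0"
proof -
  have dec: "f b \<le> f x" if "x \<le> b" for b
    by (rule DERIV_nonpos_imp_nonincreasing[OF that]) (use assms in \<open>meson order_trans\<close>)
  show ?thesis
    by (rule tendsto_upperbound[OF assms(3)])
       (auto intro!: eventually_mono[OF eventually_ge_at_top[of x]] dec)
qed

lemma hyp_kernel_tendsto_0:
  assumes "\<alpha> > 0" and "\<bar>\<beta>\<bar> < \<alpha>"
  shows "(hyp_kernel \<alpha> \<beta> \<longlongrightarrow> 0) at_top"
proof (rule tendsto_sandwich[of "\<lambda>_. 0" _ _ "\<lambda>x. exp (- ((\<alpha> - \<beta>) * x))"])
  show "((\<lambda>x. exp (- ((\<alpha> - \<beta>) * x))) \<longlongrightarrow> 0) at_top"
    using assms by (auto intro!: filterlim_compose[OF exp_at_bot] filterlim_tendsto_pos_mult_at_top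
        filterlim_ident simp: filterlim_uminus_at_bot)
  show "\<forall>\<^sub>F x in at_top. hyp_kernel \<alpha> \<beta> x \<le> exp (- ((\<alpha> - \<beta>) * x))"
  proof (rule always_eventually, intro allI)
    fix x :: real
    have "\<alpha> * x \<le> \<alpha> * sqrt (1 + x\<^sup>2)"
      using assms by (intro mult_left_mono real_le_rsqrt) auto
    thus "hyp_kernel \<alpha> \<beta> x \<le> exp (- ((\<alpha> - \<beta>) * x))"
      by (simp add: hyp_kernel_def algebra_simps)
  qed
qed (auto simp: hyp_kernel_def)

text \<open>The kernel decays at the logarithmic rate
  \<open>\<alpha> * (x / sqrt (1 + x\<^sup>2)) - \<beta>\<close>, whose limit is
  \<open>\<alpha> - \<beta>\<close>. Eventually it exceeds half the limit, hence the factor 2. The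
  result bounds the derivative of \<open>ln\<close> of the tail away from 0.\<close>

lemma hyp_tail_le_kernel:
  assumes "\<alpha> > 0" and "\<bar>\<beta>\<bar> < \<alpha>"
  obtains X where "\<And>x. x \<ge> X \<Longrightarrow> (\<alpha> - \<beta>) * hyp_tail \<alpha> \<beta> x \<le> 2 * hyp_kernel \<alpha> \<beta> x"
proof -
  let ?g = "hyp_kernel \<alpha> \<beta>"
  have "((\<lambda>x::real. x / sqrt (1 + x\<^sup>2)) \<longlongrightarrow> 1) at_top" by real_asymp
  hence "((\<lambda>x::real. \<alpha> * (x / sqrt (1 + x\<^sup>2)) - \<beta>) \<longlongrightarrow> \<alpha> * 1 - \<beta>) at_top"
    by (intro tendsto_intros)
  hence "\<forall>\<^sub>F x in at_top. \<alpha> * (x / sqrt (1 + x\<^sup>2)) - \<beta> > (\<alpha> - \<beta>) / 2"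
    using assms by (intro order_tendstoD(1)) auto
  then obtain X where X: "\<And>x. x \<ge> X \<Longrightarrow> \<alpha> * (x / sqrt (1 + x\<^sup>2)) - \<beta> > (\<alpha> - \<beta>) / 2"
    unfolding eventually_at_top_linorder by blast
  have "2 * ?g x - (\<alpha> - \<beta>) * hyp_tail \<alpha> \<beta> x \<ge> 0" if "x \<ge> X" for x
  proof (rule nonneg_if_decreasing_to_0[OF _ _ _ that])
    fix x assume x: "x \<ge> X"
    have pos: "1 + x\<^sup>2 > 0" by (simp add: add_pos_nonneg)
    have "(?g has_real_derivative ?g x * (\<beta> - \<alpha> * (x / sqrt (1 + x\<^sup>2)))) (at x)"
      unfolding hyp_kernel_def using pos
      by (auto intro!: derivative_eq_intros simp: field_simps)
    thus "((\<lambda>x. 2 * ?g x - (\<alpha> - \<beta>) * hyp_tail \<alpha> \<beta> x) has_real_derivative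
        ?g x * (\<alpha> - \<beta> - 2 * (\<alpha> * (x / sqrt (1 + x\<^sup>2)) - \<beta>))) (at x)"
      by (auto intro!: derivative_eq_intros hyp_tail_has_derivative assms simp: algebra_simps)
    show "?g x * (\<alpha> - \<beta> - 2 * (\<alpha> * (x / sqrt (1 + x\<^sup>2)) - \<beta>)) \<le> 0"
      using X[OF x] by (intro mult_nonneg_nonpos) (auto simp: hyp_kernel_def)
  next
    have "((\<lambda>x. 2 * ?g x - (\<alpha> - \<beta>) * hyp_tail \<alpha> \<beta> x) \<longlongrightarrow> 2 * 0 - (\<alpha> - \<beta>) * 0) at_top"
      by (intro tendsto_intros hyp_kernel_tendsto_0 hyp_tail_tendsto_0 assms)
    thus "((\<lambda>x. 2 * ?g x - (\<alpha> - \<beta>) * hyp_tail \<alpha> \<beta> x) \<longlongrightarrow> 0) at_top" by simp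
  qed
  with that show ?thesis by force
qed

section \<open>Elementary estimates for \<open>exp\<close>, \<open>ln\<close> and functions of
  \<open>1 / y\<close>\<close>

lemma abs_exp_minus_1_le:
  fixes u :: real
  assumes "\<bar>u\<bar> \<le> 1"
  shows "\<bar>exp u - 1\<bar> \<le> 2 * \<bar>u\<bar>"
proof (cases "u \<ge> 0")
  case True
  have "u\<^sup>2 \<le> u" using assms True by (simp add: power2_eq_square mult_left_le)
  with exp_bound[of u] assms True show ?thesis by simp
next
  case False
  hence "exp u \<le> 1" by simp
  with exp_ge_add_one_self[of u] False show ?thesis by linarith
qed

lemma abs_ln_1_plus_le:
  fixes u :: real
  assumes "\<bar>u\<bar> \<le> 1 / 2"
  shows "\<bar>ln (1 + u)\<bar> \<le> 2 * \<bar>u\<bar>"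
proof -
  have "u\<^sup>2 \<le> \<bar>u\<bar> * (1 / 2)"
    using mult_left_mono[OF assms, of "\<bar>u\<bar>"] by (simp add: power2_eq_square)
  with abs_ln_one_plus_x_minus_x_bound[OF assms] show ?thesis by linarith
qed

lemma exp_minus_1_bigo:
  fixes u :: "'a \<Rightarrow> real"
  assumes "u \<in> O[F](g)" and "(u \<longlongrightarrow> 0) F"
  shows "(\<lambda>x. exp (u x) - 1) \<in> O[F](g)"
proof -
  have "\<forall>\<^sub>F x in F. \<bar>u x\<bar> < 1"
    using tendstoD[OF assms(2), of 1] by simp
  hence "(\<lambda>x. exp (u x) - 1) \<in> O[F](u)"
    by (intro bigoI[where c = 2]) (auto elim!: eventually_mono intro: abs_exp_minus_1_le)
  thus ?thesis using assms(1) by (rule landau_o.big_trans)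
qed

lemma tendsto_inverse_power_Suc: "((\<lambda>y::real. 1 / y ^ Suc n) \<longlongrightarrow> 0) at_top"
  using tendsto_power[OF tendsto_inverse_0_at_top[OF filterlim_ident], of "Suc n"]
  by (simp add: field_simps)

lemma tendsto_poly_inverse: "((\<lambda>y::real. poly p (1 / y)) \<longlongrightarrow> poly p 0) at_top"
  using tendsto_inverse_0_at_top[OF filterlim_ident]
  by (intro tendsto_poly) (simp add: field_simps)

section \<open>The truncated expansion as an approximate solution\<close>

text \<open>The \<open>P\<close> of the overview, as a function of \<open>y\<close> rather than
  \<open>u\<close>.\<close>

definition quantile_approx :: "real \<Rightarrow> real \<Rightarrow> nat \<Rightarrow> real \<Rightarrow> real" where
  "quantile_approx \<alpha> \<beta> N y = y + poly (trunc_poly (coeff_q \<alpha> \<beta>) N) (1 / y)"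

definition quantile_approx_deriv :: "real \<Rightarrow> real \<Rightarrow> nat \<Rightarrow> real \<Rightarrow> real" where
  "quantile_approx_deriv \<alpha> \<beta> N y
     = 1 - (1 / y)\<^sup>2 * poly (pderiv (trunc_poly (coeff_q \<alpha> \<beta>) N)) (1 / y)"

lemma quantile_approx_has_derivative:
  assumes "y \<noteq> 0"
  shows "(quantile_approx \<alpha> \<beta> N has_real_derivative quantile_approx_deriv \<alpha> \<beta> N y) (at y)"
proof -
  have "((\<lambda>y. 1 / y) has_real_derivative - (1 / y)\<^sup>2) (at y)"
    using assms by (auto intro!: derivative_eq_intros simp: power2_eq_square)
  from DERIV_add[OF DERIV_ident DERIV_chain2[OF poly_DERIV this]]
  have "((\<lambda>y. y + poly p (1 / y)) has_real_derivative 1 + poly (pderiv p) (1 / y) * - (1 / y)\<^sup>2) (at y)" for p .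
  from this[of "trunc_poly (coeff_q \<alpha> \<beta>) N"] show ?thesis
    unfolding quantile_approx_def[abs_def] quantile_approx_deriv_def
    by (simp add: mult.commute)
qed

lemma quantile_approx_at_top: "filterlim (quantile_approx \<alpha> \<beta> N) at_top at_top"
  unfolding quantile_approx_def[abs_def]
  using filterlim_tendsto_add_at_top[OF tendsto_poly_inverse filterlim_ident]
  by (simp add: add.commute)

text \<open>For the root \<open>S\<close> and its approximation \<open>T\<close>,
  \<open>S\<^sup>2 - T\<^sup>2\<close> is \<open>y\<close> times a polynomial in
  \<open>1 / y\<close> whose low coefficients vanish by \<open>coeff_a_eq\<close>. Dividing by
  \<open>S + T\<close>, which is at least \<open>y / 2\<close>, removes the factor
  \<open>y\<close>.\<close>

lemma sqrt_quantile_approx_bigo: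
  assumes "N \<ge> 1"
  shows "(\<lambda>y. sqrt (1 + (quantile_approx \<alpha> \<beta> N y)\<^sup>2) - (y + poly (trunc_poly (coeff_a \<alpha> \<beta>) N) (1 / y)))
      \<in> O(\<lambda>y. 1 / y ^ Suc N)"
proof -
  define p where "p = trunc_poly (coeff_q \<alpha> \<beta>) N"
  define a where "a = trunc_poly (coeff_a \<alpha> \<beta>) N"
  \<comment> \<open>\<open>r\<close> is \<open>(1 + P\<^sup>2 - T\<^sup>2) / y\<close> in the
    variable \<open>1 / y\<close>. At degree 1 the summand \<open>[:0, 1:]\<close> is cancelled by
    the \<open>1 / 2\<close> in \<open>coeff_a\<close>.\<close>
  define r where "r = [:0, 1:] + smult 2 (p - a) + pCons 0 (p * p - a * a)"
  have "coeff r n = 0" if n: "n < Suc N" for n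
  proof -
    consider "n = 0" | "n = 1" | k where "n = Suc (Suc k)"
      by (metis One_nat_def not0_implies_Suc)
    thus ?thesis
    proof cases
      case 3
      have sums: "coeff (trunc_poly f N * trunc_poly f N) (Suc k) = (\<Sum>i\<le>Suc k. f i * f (Suc k - i))"
        for f :: "nat \<Rightarrow> real"
        unfolding coeff_mult using n 3 by (intro sum.cong) auto
      have "coeff r n = 2 * (coeff_q \<alpha> \<beta> n - coeff_a \<alpha> \<beta> n)
          + (coeff (p * p) (Suc k) - coeff (a * a) (Suc k))"
        using n 3 by (simp add: r_def p_def a_def)
      moreover have "coeff (p * p) (Suc k) - coeff (a * a) (Suc k)
          = 2 * (coeff_a \<alpha> \<beta> n - coeff_q \<alpha> \<beta> n)"
        unfolding p_def a_def sums 3 by (rule coeff_a_eq[symmetric])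
      ultimately show ?thesis by (simp only:) simp
    qed (use assms in \<open>auto simp: r_def p_def a_def coeff_mult coeff_a.simps[of _ _ "Suc 0"]\<close>)
  qed
  hence r: "(\<lambda>y. poly r (1 / y)) \<in> O(\<lambda>y. 1 / y ^ Suc N)"
    by (rule poly_bigo_of_low_coeffs_0)
  have "((\<lambda>y. poly a (1 / y)) \<longlongrightarrow> 0) at_top"
    using tendsto_poly_inverse[of a] by (simp add: a_def poly_0_coeff_0)
  hence "\<forall>\<^sub>F y in at_top. \<bar>poly a (1 / y)\<bar> < 1"
    by (auto dest!: tendstoD[where e = 1])
  hence "\<forall>\<^sub>F y in at_top. norm (sqrt (1 + (quantile_approx \<alpha> \<beta> N y)\<^sup>2) - (y + poly a (1 / y)))
      \<le> 2 * norm (poly r (1 / y))"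
    using eventually_ge_at_top[of 2]
  proof eventually_elim
    case (elim y)
    define P where "P = quantile_approx \<alpha> \<beta> N y"
    define S where "S = sqrt (1 + P\<^sup>2)"
    define T where "T = y + poly a (1 / y)"
    have T: "T \<ge> y / 2" using elim by (simp add: T_def abs_less_iff)
    have S: "S \<ge> 0" "S\<^sup>2 = 1 + P\<^sup>2" by (simp_all add: S_def add_nonneg_nonneg)
    have P: "P = y + poly p (1 / y)" by (simp add: P_def p_def quantile_approx_def)
    have "(S - T) * (S + T) = 1 + P\<^sup>2 - T\<^sup>2"
      using S(2) by (simp add: algebra_simps power2_eq_square)
    also have "\<dots> = y * poly r (1 / y)"
      using elim unfolding P T_def r_def by (simp add: field_simps power2_eq_square)
    finally have "\<bar>S - T\<bar> * (S + T) = y * \<bar>poly r (1 / y)\<bar>"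
      using S T elim by (metis abs_mult abs_of_nonneg add_nonneg_nonneg divide_nonneg_nonneg
          order_trans zero_le_numeral)
    moreover have "\<bar>S - T\<bar> * (y / 2) \<le> \<bar>S - T\<bar> * (S + T)"
      using S T by (intro mult_left_mono) auto
    ultimately have "y * \<bar>S - T\<bar> \<le> y * (2 * \<bar>poly r (1 / y)\<bar>)" by (simp add: mult_ac)
    thus ?case using elim by (simp add: S_def T_def P_def)
  qed
  hence "(\<lambda>y. sqrt (1 + (quantile_approx \<alpha> \<beta> N y)\<^sup>2) - (y + poly a (1 / y))) \<in> O(\<lambda>y. poly r (1 / y))"
    by (rule bigoI)
  thus ?thesis using r unfolding a_def by (rule landau_o.big_trans)
qed

text \<open>With \<open>P\<close> the truncated expansion, \<open>exp ((\<alpha> - \<beta>) y) g(P) P'\<close> would be exactly 1 if \<open>P\<close>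
  were the quantile as a function of \<open>y\<close>.\<close>
lemma quantile_approx_ode_bigo:
  assumes "\<alpha> \<noteq> \<beta>" "N \<ge> 1"
  shows "(\<lambda>y. hyp_kernel \<alpha> \<beta> (quantile_approx \<alpha> \<beta> N y) * quantile_approx_deriv \<alpha> \<beta> N y
              * exp ((\<alpha> - \<beta>) * y) - 1) \<in> O(\<lambda>y. 1 / y ^ Suc N)"
proof -
  define p where "p = trunc_poly (coeff_q \<alpha> \<beta>) N"
  define a where "a = trunc_poly (coeff_a \<alpha> \<beta>) N"
  define b where "b = trunc_poly (coeff_b \<alpha> \<beta>) N"
  define c where "c = trunc_poly (coeff_c \<alpha> \<beta>) N"
  \<comment> \<open>The derivative of the approximation as a polynomial in \<open>1 / y\<close>; the
    two shifts stem from the derivative of \<open>1 / y\<close>.\<close>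
  define D where "D = [:1:] - pCons 0 (pCons 0 (pderiv p))"
  define u where "u y = sqrt (1 + (quantile_approx \<alpha> \<beta> N y)\<^sup>2) - (y + poly a (1 / y))" for y
  have u: "u \<in> O(\<lambda>y. 1 / y ^ Suc N)"
    unfolding u_def[abs_def] a_def by (rule sqrt_quantile_approx_bigo[OF assms(2)])
  have "(u \<longlongrightarrow> 0) at_top"
    using landau_o.big_small_trans[OF u smalloI_tendsto[of _ "\<lambda>_. 1"]] tendsto_inverse_power_Suc[of N]
    by (auto dest: smalloD_tendsto)
  hence X: "(\<lambda>y. exp (- \<alpha> * u y) - 1) \<in> O(\<lambda>y. 1 / y ^ Suc N)"
    using u by (intro exp_minus_1_bigo tendsto_mult_right_zero) auto
  have "b = smult \<alpha> a - smult \<beta> p"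
    by (rule poly_eqI) (simp add: a_def b_def p_def coeff_b.simps)
  hence b: "poly b x = \<alpha> * poly a x - \<beta> * poly p x" for x by simp
  have D: "quantile_approx_deriv \<alpha> \<beta> N y = poly D (1 / y)" for y
    by (simp add: quantile_approx_deriv_def D_def p_def power2_eq_square mult_ac)
  have BC: "(\<lambda>y. exp (- poly b (1 / y)) * poly c (1 / y) - 1) \<in> O(\<lambda>y. 1 / y ^ Suc N)"
  proof (rule poly_exp_bigo)
    fix n assume n: "n < N"
    have "coeff (pderiv b * c) n
        = (\<Sum>i\<le>n. real (Suc i) * coeff_b \<alpha> \<beta> (Suc i) * coeff_c \<alpha> \<beta> (n - i))"
      unfolding coeff_mult using n
      by (intro sum.cong refl) (auto simp: b_def c_def coeff_pderiv)
    moreover have "coeff (pderiv c) n = real (Suc n) * coeff_c \<alpha> \<beta> (Suc n)"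
      using n by (simp add: c_def coeff_pderiv)
    ultimately show "coeff (pderiv c - pderiv b * c) n = 0"
      using coeff_c_recurrence[of n \<alpha> \<beta>] by simp
  qed (simp_all add: b_def c_def)
  \<comment> \<open>Up to degree \<open>N\<close>, \<open>coeff_c_1\<close> and
    \<open>coeff_c_eq\<close> identify \<open>c\<close> with the series of the derivative.\<close>
  have "coeff (D - c) n = 0" if n: "n < Suc N" for n
  proof -
    consider "n = 0" | "n = 1" | k where "n = Suc (Suc k)"
      by (metis One_nat_def not0_implies_Suc)
    thus ?thesis
      by cases (use n coeff_c_1[OF assms(1)] coeff_c_eq[OF assms(1)] in
          \<open>auto simp: D_def c_def p_def coeff_pderiv algebra_simps\<close>)
  qed
  hence DC: "(\<lambda>y. poly (D - c) (1 / y)) \<in> O(\<lambda>y. 1 / y ^ Suc N)"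
    by (rule poly_bigo_of_low_coeffs_0)
  have B: "(\<lambda>y. exp (- poly b (1 / y))) \<in> O(\<lambda>_. 1)"
    by (rule bigoI_tendsto[where c = "exp (- poly b 0)"])
       (auto intro!: tendsto_intros tendsto_poly_inverse)
  have BD: "(\<lambda>y. exp (- poly b (1 / y)) * poly D (1 / y)) \<in> O(\<lambda>_. 1)"
    by (rule bigoI_tendsto[where c = "exp (- poly b 0) * poly D 0"])
       (auto intro!: tendsto_intros tendsto_poly_inverse)
  \<comment> \<open>A telescoping sum: the root error is dropped, then \<open>D\<close> is replaced
    by \<open>c\<close>, and finally \<open>exp (- b) * c\<close> by 1.\<close>
  have "(\<lambda>y. (exp (- \<alpha> * u y) - 1) * (exp (- poly b (1 / y)) * poly D (1 / y))
      + exp (- poly b (1 / y)) * poly (D - c) (1 / y)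
      + (exp (- poly b (1 / y)) * poly c (1 / y) - 1)) \<in> O(\<lambda>y. 1 / y ^ Suc N)"
    using landau_o.big.mult[OF X BD] landau_o.big.mult[OF B DC] BC
    by (intro sum_in_bigo(1)) simp_all
  also have "(\<lambda>y. (exp (- \<alpha> * u y) - 1) * (exp (- poly b (1 / y)) * poly D (1 / y))
      + exp (- poly b (1 / y)) * poly (D - c) (1 / y)
      + (exp (- poly b (1 / y)) * poly c (1 / y) - 1))
      = (\<lambda>y. hyp_kernel \<alpha> \<beta> (quantile_approx \<alpha> \<beta> N y) * quantile_approx_deriv \<alpha> \<beta> N y
              * exp ((\<alpha> - \<beta>) * y) - 1)"
  proof
    fix y
    \<comment> \<open>The terms linear in \<open>y\<close> cancel, leaving the root error
      \<open>u\<close> and \<open>b = \<alpha> * a - \<beta> * p\<close>.\<close>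
    have "hyp_kernel \<alpha> \<beta> (quantile_approx \<alpha> \<beta> N y) * exp ((\<alpha> - \<beta>) * y)
        = exp (- \<alpha> * u y) * exp (- poly b (1 / y))"
      unfolding hyp_kernel_def exp_add[symmetric] b u_def
      by (simp add: quantile_approx_def p_def algebra_simps)
    hence "hyp_kernel \<alpha> \<beta> (quantile_approx \<alpha> \<beta> N y) * quantile_approx_deriv \<alpha> \<beta> N y
              * exp ((\<alpha> - \<beta>) * y)
        = exp (- \<alpha> * u y) * exp (- poly b (1 / y)) * poly D (1 / y)"
      by (simp add: D mult_ac)
    thus "(exp (- \<alpha> * u y) - 1) * (exp (- poly b (1 / y)) * poly D (1 / y))
      + exp (- poly b (1 / y)) * poly (D - c) (1 / y)
      + (exp (- poly b (1 / y)) * poly c (1 / y) - 1)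
      = hyp_kernel \<alpha> \<beta> (quantile_approx \<alpha> \<beta> N y) * quantile_approx_deriv \<alpha> \<beta> N y
              * exp ((\<alpha> - \<beta>) * y) - 1"
      by (simp add: algebra_simps)
  qed
  finally show ?thesis .
qed

lemma hyp_tail_quantile_approx:
  assumes "\<alpha> > 0" and "\<bar>\<beta>\<bar> < \<alpha>" and "N \<ge> 1"
  obtains K where "K > 0" and "\<forall>\<^sub>F y in at_top.
    \<bar>(\<alpha> - \<beta>) * hyp_tail \<alpha> \<beta> (quantile_approx \<alpha> \<beta> N y) - exp (- ((\<alpha> - \<beta>) * y))\<bar>
      \<le> K / y ^ Suc N * exp (- ((\<alpha> - \<beta>) * y))"
proof -
  define \<delta> where "\<delta> = \<alpha> - \<beta>"
  have \<delta>: "\<delta> > 0" using assms by (simp add: \<delta>_def)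
  let ?P = "quantile_approx \<alpha> \<beta> N" and ?G = "hyp_tail \<alpha> \<beta>"
  define e where "e y = hyp_kernel \<alpha> \<beta> (?P y) * quantile_approx_deriv \<alpha> \<beta> N y * exp (\<delta> * y) - 1" for y
  have "e \<in> O(\<lambda>y. 1 / y ^ Suc N)"
    unfolding e_def[abs_def] \<delta>_def using assms by (intro quantile_approx_ode_bigo) auto
  then obtain K where K: "K > 0" "\<forall>\<^sub>F y in at_top. norm (e y) \<le> K * norm (1 / y ^ Suc N)"
    by (rule landau_o.bigE)
  then obtain Y0 where Y0: "\<And>y. y \<ge> Y0 \<Longrightarrow> \<bar>e y\<bar> \<le> K * norm (1 / y ^ Suc N)"
    unfolding eventually_at_top_linorder by auto
  define Y where "Y = max 1 Y0"
  have Y: "\<bar>e y\<bar> \<le> K / y ^ Suc N" "y > 0" if "y \<ge> Y" for y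
    using Y0[of y] that by (auto simp: Y_def)
  \<comment> \<open>Nonnegativity for \<open>s = 1\<close> and \<open>s = -1\<close> gives the two
    sides of the estimate in one argument.\<close>
  define f where "f s y = K / y ^ Suc N * exp (- (\<delta> * y)) + s * (\<delta> * ?G (?P y) - exp (- (\<delta> * y)))"
    for s y :: real
  \<comment> \<open>The first summand, from differentiating the power of \<open>y\<close>, already
    has the right sign; in the second, the bound on \<open>e\<close> makes the bracket
    nonnegative.\<close>
  define f' where "f' s y = - (K * real (Suc N) / y ^ Suc (Suc N) * exp (- (\<delta> * y)))
      - \<delta> * exp (- (\<delta> * y)) * (K / y ^ Suc N + s * e y)" for s y :: real
  have "f s y \<ge> 0" if s: "\<bar>s\<bar> = 1" and y: "y \<ge> Y" for s y
  proof (rule nonneg_if_decreasing_to_0[OF _ _ _ y])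
    fix y assume y: "y \<ge> Y"
    have y0: "y > 0" using Y(2)[OF y] .
    have "((\<lambda>y. K / y ^ Suc N) has_real_derivative - (K * real (Suc N) / y ^ Suc (Suc N))) (at y)"
      using DERIV_cmult[OF DERIV_inverse_fun[OF DERIV_pow[of "Suc N" y]], of K] y0
      by (simp add: field_simps del: of_nat_Suc)
    moreover have "((\<lambda>y. exp (- (\<delta> * y))) has_real_derivative - \<delta> * exp (- (\<delta> * y))) (at y)"
      by (auto intro!: derivative_eq_intros)
    moreover have "((\<lambda>y. ?G (?P y)) has_real_derivative
        - hyp_kernel \<alpha> \<beta> (?P y) * quantile_approx_deriv \<alpha> \<beta> N y) (at y)"
      using y0 by (intro DERIV_chain2[OF hyp_tail_has_derivative] quantile_approx_has_derivative assms) auto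
    ultimately have "(f s has_real_derivative
        (- (K * real (Suc N) / y ^ Suc (Suc N)) * exp (- (\<delta> * y))
          + - \<delta> * exp (- (\<delta> * y)) * (K / y ^ Suc N))
        + s * (\<delta> * (- hyp_kernel \<alpha> \<beta> (?P y) * quantile_approx_deriv \<alpha> \<beta> N y)
            - (- \<delta> * exp (- (\<delta> * y))))) (at y)"
      unfolding f_def[abs_def] by (intro DERIV_add DERIV_mult DERIV_cmult DERIV_diff)
    moreover have "hyp_kernel \<alpha> \<beta> (?P y) * quantile_approx_deriv \<alpha> \<beta> N y
        = exp (- (\<delta> * y)) * (1 + e y)"
      by (simp add: e_def exp_minus field_simps)
    ultimately show "(f s has_real_derivative f' s y) (at y)"
      unfolding f'_def by (elim DERIV_cong) algebra
    have "\<bar>s * e y\<bar> \<le> K / y ^ Suc N" using Y(1)[OF y] s by (simp add: abs_mult)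
    hence "K / y ^ Suc N + s * e y \<ge> 0" by linarith
    hence "\<delta> * exp (- (\<delta> * y)) * (K / y ^ Suc N + s * e y) \<ge> 0"
      using \<delta> by (intro mult_nonneg_nonneg) auto
    moreover have "K * real (Suc N) / y ^ Suc (Suc N) * exp (- (\<delta> * y)) \<ge> 0"
      using K(1) y0 by (intro mult_nonneg_nonneg divide_nonneg_nonneg) auto
    ultimately show "f' s y \<le> 0" unfolding f'_def by linarith
  next
    have 1: "((\<lambda>y. exp (- (\<delta> * y))) \<longlongrightarrow> 0) at_top"
      using \<delta> by real_asymp
    have 2: "((\<lambda>y. K * (1 / y ^ Suc N) * exp (- (\<delta> * y))
        + s * (\<delta> * ?G (?P y) - exp (- (\<delta> * y)))) \<longlongrightarrow> K * 0 * 0 + s * (\<delta> * 0 - 0)) at_top"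
      by (intro tendsto_intros 1 tendsto_inverse_power_Suc
          filterlim_compose[OF hyp_tail_tendsto_0 quantile_approx_at_top] assms)
    thus "(f s \<longlongrightarrow> 0) at_top" by (simp add: f_def[abs_def])
  qed
  from this[of 1] this[of "-1"] have "\<forall>y\<ge>Y. \<bar>\<delta> * ?G (?P y) - exp (- (\<delta> * y))\<bar>
      \<le> K / y ^ Suc N * exp (- (\<delta> * y))"
    unfolding f_def by (force simp: abs_le_iff)
  thus ?thesis
    by (intro that[OF K(1)]) (auto simp: \<delta>_def eventually_at_top_linorder)
qed

section \<open>From the tail back to the quantile\<close>

text \<open>Converts a relative error of the tail into an absolute error of its argument. By
  \<open>hyp_tail_le_kernel\<close>, adding \<open>(\<alpha> - \<beta>) / 2 * x\<close> to
  \<open>ln\<close> of the tail still leaves a nonincreasing function beyond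
  \<open>X\<close>.\<close>

lemma ln_hyp_tail_diff:
  assumes "\<alpha> > 0" and "\<bar>\<beta>\<bar> < \<alpha>"
  obtains X where "\<And>a b. X \<le> a \<Longrightarrow> X \<le> b \<Longrightarrow>
    (\<alpha> - \<beta>) / 2 * \<bar>a - b\<bar> \<le> \<bar>ln (hyp_tail \<alpha> \<beta> a) - ln (hyp_tail \<alpha> \<beta> b)\<bar>"
proof -
  let ?G = "hyp_tail \<alpha> \<beta>"
  obtain X where X: "\<And>x. x \<ge> X \<Longrightarrow> (\<alpha> - \<beta>) * ?G x \<le> 2 * hyp_kernel \<alpha> \<beta> x"
    using hyp_tail_le_kernel[OF assms] by blast
  have *: "(\<alpha> - \<beta>) / 2 * (b - a) \<le> ln (?G a) - ln (?G b)" if "X \<le> a" "a \<le> b" for a b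
  proof -
    have "ln (?G b) + (\<alpha> - \<beta>) / 2 * b \<le> ln (?G a) + (\<alpha> - \<beta>) / 2 * a"
    proof (rule DERIV_nonpos_imp_nonincreasing[OF that(2)])
      fix x assume x: "a \<le> x"
      have G: "?G x > 0" by (rule hyp_tail_pos[OF assms])
      have "((\<lambda>x. ln (?G x) + (\<alpha> - \<beta>) / 2 * x) has_real_derivative
          - hyp_kernel \<alpha> \<beta> x / ?G x + (\<alpha> - \<beta>) / 2) (at x)"
        using G by (auto intro!: derivative_eq_intros hyp_tail_has_derivative assms)
      moreover have "- hyp_kernel \<alpha> \<beta> x / ?G x + (\<alpha> - \<beta>) / 2 \<le> 0"
        using X[of x] x that G by (simp add: field_simps)
      ultimately show "\<exists>y. ((\<lambda>x. ln (?G x) + (\<alpha> - \<beta>) / 2 * x) has_real_derivative y) (at x) \<and> y \<le> 0"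
        by blast
    qed
    thus ?thesis unfolding right_diff_distrib by linarith
  qed
  show ?thesis
  proof (rule that)
    fix a b assume "X \<le> a" "X \<le> b"
    thus "(\<alpha> - \<beta>) / 2 * \<bar>a - b\<bar> \<le> \<bar>ln (?G a) - ln (?G b)\<bar>"
      using *[of a b] *[of b a] by (cases "a \<le> b") (auto simp: abs_if)
  qed
qed

lemma hyp_y_at_top:
  assumes "\<alpha> > 0" and "\<bar>\<beta>\<bar> < \<alpha>"
  shows "filterlim (hyp_y \<alpha> \<beta>) at_top (at_left 1)"
proof -
  define c where "c = hyp_N0 \<alpha> \<beta> * (\<alpha> - \<beta>)"
  define \<delta> where "\<delta> = \<alpha> - \<beta>"
  have "c > 0" "\<delta> > 0" using hyp_tail_eq_cdf(1)[OF assms] assms by (auto simp: c_def \<delta>_def)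
  hence "filterlim (\<lambda>u. - ln (c * (1 - u)) / \<delta>) at_top (at_left 1)" by real_asymp
  thus ?thesis by (simp add: hyp_y_def[abs_def] c_def \<delta>_def)
qed

text \<open>Brings the quantile into the range where \<open>ln_hyp_tail_diff\<close> applies: the
  tail at the quantile tends to 0, hence falls below the tail at \<open>X\<close>.\<close>

lemma hyp_quantile_ge:
  assumes "\<alpha> > 0" and "\<bar>\<beta>\<bar> < \<alpha>"
  shows "\<forall>\<^sub>F u in at_left 1. X \<le> hyp_quantile \<alpha> \<beta> u"
proof -
  have "((\<lambda>u. hyp_N0 \<alpha> \<beta> * (1 - u)) \<longlongrightarrow> hyp_N0 \<alpha> \<beta> * (1 - 1)) (at_left 1)"
    by (intro tendsto_intros)
  hence "\<forall>\<^sub>F u in at_left 1. hyp_N0 \<alpha> \<beta> * (1 - u) < hyp_tail \<alpha> \<beta> X"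
    using hyp_tail_pos[OF assms, of X] by (intro order_tendstoD(2)) auto
  with hyp_tail_quantile[OF assms] show ?thesis
  proof eventually_elim
    case (elim u)
    thus ?case
      using hyp_tail_strict_antimono[OF assms, of "hyp_quantile \<alpha> \<beta> u" X]
      by (cases "X \<le> hyp_quantile \<alpha> \<beta> u") auto
  qed
qed

lemma hyp_quantile_minus_approx_bigo:
  assumes "\<alpha> > 0" and "\<bar>\<beta>\<bar> < \<alpha>" and "N \<ge> 1"
  shows "(\<lambda>u. hyp_quantile \<alpha> \<beta> u - quantile_approx \<alpha> \<beta> N (hyp_y \<alpha> \<beta> u))
      \<in> O[at_left 1](\<lambda>u. 1 / hyp_y \<alpha> \<beta> u ^ Suc N)"
proof -
  define \<delta> where "\<delta> = \<alpha> - \<beta>"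
  have \<delta>: "\<delta> > 0" using assms by (simp add: \<delta>_def)
  let ?P = "quantile_approx \<alpha> \<beta> N" and ?G = "hyp_tail \<alpha> \<beta>" and ?y = "hyp_y \<alpha> \<beta>"
    and ?Q = "hyp_quantile \<alpha> \<beta>"
  obtain K where K: "K > 0" "\<forall>\<^sub>F y in at_top. \<bar>\<delta> * ?G (?P y) - exp (- (\<delta> * y))\<bar>
      \<le> K / y ^ Suc N * exp (- (\<delta> * y))"
    by (rule hyp_tail_quantile_approx[OF assms, folded \<delta>_def])
  obtain X where X: "\<And>a b. X \<le> a \<Longrightarrow> X \<le> b \<Longrightarrow> \<delta> / 2 * \<bar>a - b\<bar> \<le> \<bar>ln (?G a) - ln (?G b)\<bar>"
    by (rule ln_hyp_tail_diff[OF assms(1,2), folded \<delta>_def]) blast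
  have "((\<lambda>y. K / y ^ Suc N) \<longlongrightarrow> 0) at_top"
    using tendsto_mult_right_zero[OF tendsto_inverse_power_Suc[of N], of K] by simp
  \<comment> \<open>The threshold \<open>1 / 2\<close> is what \<open>abs_ln_1_plus_le\<close>
    demands.\<close>
  hence "\<forall>\<^sub>F y in at_top. K / y ^ Suc N < 1 / 2" by (rule order_tendstoD(2)) simp
  moreover have "\<forall>\<^sub>F y in at_top. X \<le> ?P y"
    using quantile_approx_at_top[of \<alpha> \<beta> N] by (simp add: filterlim_at_top)
  ultimately have "\<forall>\<^sub>F y in at_top. y > 0 \<and> K / y ^ Suc N < 1 / 2 \<and> X \<le> ?P y \<and>
      \<bar>\<delta> * ?G (?P y) - exp (- (\<delta> * y))\<bar> \<le> K / y ^ Suc N * exp (- (\<delta> * y))"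
    using K(2) eventually_gt_at_top[of 0] by eventually_elim blast
  hence "\<forall>\<^sub>F u in at_left 1. ?y u > 0 \<and> K / ?y u ^ Suc N < 1 / 2 \<and> X \<le> ?P (?y u) \<and>
      \<bar>\<delta> * ?G (?P (?y u)) - exp (- (\<delta> * ?y u))\<bar> \<le> K / ?y u ^ Suc N * exp (- (\<delta> * ?y u))"
    by (rule eventually_compose_filterlim[OF _ hyp_y_at_top[OF assms(1,2)]])
  moreover have "\<forall>\<^sub>F u in at_left (1::real). u < 1" by (simp add: eventually_at_filter)
  \<comment> \<open>In \<open>4 * K / \<delta>\<close>, a factor 2 comes from
    \<open>abs_ln_1_plus_le\<close> and \<open>2 / \<delta>\<close> from
    \<open>ln_hyp_tail_diff\<close>.\<close>
  ultimately have "\<forall>\<^sub>F u in at_left 1. norm (?Q u - ?P (?y u))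
      \<le> 4 * K / \<delta> * norm (1 / ?y u ^ Suc N)"
    using hyp_tail_quantile[OF assms(1,2)] hyp_quantile_ge[OF assms(1,2), of X]
  proof eventually_elim
    case (elim u)
    define E where "E = exp (- (\<delta> * ?y u))"
    \<comment> \<open>By the choice of \<open>y\<close>, \<open>E\<close> equals
      \<open>\<delta>\<close> times the tail at the quantile, so \<open>1 + \<epsilon>\<close> is
      the ratio of the two tails.\<close>
    define \<epsilon> where "\<epsilon> = \<delta> * ?G (?P (?y u)) / E - 1"
    have E: "E > 0" by (simp add: E_def)
    have "E = exp (ln (hyp_N0 \<alpha> \<beta> * \<delta> * (1 - u)))"
      using \<delta> by (simp add: E_def hyp_y_def \<delta>_def)
    also have "\<dots> = hyp_N0 \<alpha> \<beta> * \<delta> * (1 - u)"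
      using \<delta> elim hyp_tail_eq_cdf(1)[OF assms(1,2)] by simp
    finally have GQ: "\<delta> * ?G (?Q u) = E" using elim by simp
    have "\<bar>\<epsilon>\<bar> = \<bar>\<delta> * ?G (?P (?y u)) - E\<bar> / E"
      using E by (simp add: \<epsilon>_def field_simps abs_divide flip: abs_of_pos)
    also have "\<dots> \<le> K / ?y u ^ Suc N"
      using elim E by (simp add: E_def divide_le_eq)
    finally have \<epsilon>: "\<bar>\<epsilon>\<bar> \<le> K / ?y u ^ Suc N" .
    have "1 + \<epsilon> = ?G (?P (?y u)) / ?G (?Q u)"
      using \<delta> by (simp add: \<epsilon>_def flip: GQ)
    hence "ln (1 + \<epsilon>) = ln (?G (?P (?y u))) - ln (?G (?Q u))"
      using hyp_tail_pos[OF assms(1,2), THEN less_imp_neq, THEN not_sym] by (simp add: ln_div)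
    moreover have "\<bar>ln (1 + \<epsilon>)\<bar> \<le> 2 * \<bar>\<epsilon>\<bar>"
      using \<epsilon> elim by (intro abs_ln_1_plus_le) linarith
    ultimately have "\<delta> / 2 * \<bar>?P (?y u) - ?Q u\<bar> \<le> 2 * (K / ?y u ^ Suc N)"
      using X[of "?P (?y u)" "?Q u"] elim \<epsilon> by linarith
    moreover have "t \<le> 4 * w / \<delta>" if "\<delta> / 2 * t \<le> 2 * w" for t w
      using that \<delta> by (simp add: field_simps)
    ultimately have "\<bar>?P (?y u) - ?Q u\<bar> \<le> 4 * (K / ?y u ^ Suc N) / \<delta>" by blast
    hence "\<bar>?P (?y u) - ?Q u\<bar> \<le> 4 * K / \<delta> * (1 / ?y u ^ Suc N)" by (simp add: mult_ac)
    thus ?case using elim by (simp add: abs_minus_commute)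
  qed
  thus ?thesis by (rule bigoI)
qed

theorem mainTheorem2:
  fixes \<alpha> \<beta> :: real
  assumes "\<alpha> > 0" and "\<bar>\<beta>\<bar> < \<alpha>"
  shows "\<forall>N\<ge>1.
    (\<lambda>u. hyp_quantile \<alpha> \<beta> u - hyp_y \<alpha> \<beta> u - (\<Sum>n=1..N. coeff_q \<alpha> \<beta> n / hyp_y \<alpha> \<beta> u ^ n))
      \<in> o[at_left 1](\<lambda>u. 1 / hyp_y \<alpha> \<beta> u ^ N)"
proof (intro allI impI)
  fix N :: nat assume N: "N \<ge> 1"
  have "poly (trunc_poly (coeff_q \<alpha> \<beta>) N) (1 / y) = (\<Sum>n=1..N. coeff_q \<alpha> \<beta> n / y ^ n)" for y
  proof -
    \<comment> \<open>The constant term is \<open>coeff_q\<close> at 0, which is 0.\<close>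
    have "{..N} = insert 0 {1..N}" by auto
    thus ?thesis by (simp add: poly_trunc_poly power_one_over)
  qed
  hence eq: "hyp_quantile \<alpha> \<beta> u - hyp_y \<alpha> \<beta> u - (\<Sum>n=1..N. coeff_q \<alpha> \<beta> n / hyp_y \<alpha> \<beta> u ^ n)
      = hyp_quantile \<alpha> \<beta> u - quantile_approx \<alpha> \<beta> N (hyp_y \<alpha> \<beta> u)" for u
    by (simp add: quantile_approx_def)
  \<comment> \<open>The spare factor \<open>1 / y\<close> in the error bound turns big O at order
    \<open>Suc N\<close> into little o at order \<open>N\<close>.\<close>
  have "(\<lambda>y::real. 1 / y * (1 / y ^ N)) \<in> o(\<lambda>y. 1 * (1 / y ^ N))"
    by (rule landau_o.small_big_mult) (real_asymp, simp)
  hence "(\<lambda>y::real. 1 / y ^ Suc N) \<in> o(\<lambda>y. 1 / y ^ N)" by simp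
  hence "(\<lambda>u. 1 / hyp_y \<alpha> \<beta> u ^ Suc N) \<in> o[at_left 1](\<lambda>u. 1 / hyp_y \<alpha> \<beta> u ^ N)"
    by (rule landau_o.small.compose[OF _ hyp_y_at_top[OF assms]])
  with hyp_quantile_minus_approx_bigo[OF assms N]
  show "(\<lambda>u. hyp_quantile \<alpha> \<beta> u - hyp_y \<alpha> \<beta> u - (\<Sum>n=1..N. coeff_q \<alpha> \<beta> n / hyp_y \<alpha> \<beta> u ^ n))
      \<in> o[at_left 1](\<lambda>u. 1 / hyp_y \<alpha> \<beta> u ^ N)"
    unfolding eq by (rule landau_o.big_small_trans)
qed

end
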